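(* Let $I\subset\mathbb{R}$ be an interval and let $\gamma:I\to\mathbb{R}^4$ be a non-degenerate curve parametrized by arc-length $s$, with Frenet frame $\{\mathbf{t},\mathbf{n}_1,\mathbf{n}_2,\mathbf{n}_3\}$ and curvatures $\kappa_1,\kappa_2,\kappa_3$. Let $\lambda$ be a non-zero constant and put $\overline{\gamma}(s)=\gamma(s)+\lambda\mathbf{n}_1(s)$. Then $\gamma$ and $\overline{\gamma}$ are third mates with $\overline{\gamma}(s)=\gamma(s)+\lambda \mathbf{n}_1(s)$ (that is, $\overline\gamma$ is a non-degenerate curve and $\mathbf{n}_1(s)=\pm\overline{\mathbf{n}}_3(s)$ for all $s\in I$) if and only if $\kappa_1(s)$ and $\kappa_2(s)$ are positive constants with $\lambda(\kappa_1^2+\kappa_2^2)=\kappa_1$ and $\kappa_3(s)\neq0$ for all $s\in I$.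
   Context: All maps are $C^\infty$. For $\mathbf{a},\mathbf{b},\mathbf{c}\in\mathbb{R}^4$ the vector product $\mathbf{a}\times\mathbf{b}\times\mathbf{c}\in\mathbb{R}^4$ is the vector with $(\mathbf{a}\times\mathbf{b}\times\mathbf{c})\cdot\mathbf{x}=\det(\mathbf{a},\mathbf{b},\mathbf{c},\mathbf{x})$ for all $\mathbf{x}$. A regular curve $\gamma:I\to\mathbb{R}^4$ ($\dot\gamma(t)\neq0$ for all $t$) is non-degenerate if $\dot\gamma(t)\times\ddot\gamma(t)\times\dddot\gamma(t)\ne0$ for all $t\in I$. The Frenet frame of a non-degenerate curve (in a general parameter $t$) is $$\mathbf{t}=\frac{\dot\gamma}{|\dot\gamma|},\quad \mathbf{n}_1=\frac{\dot{\mathbf{t}}}{|\dot{\mathbf{t}}|},\quad \mathbf{n}_3=\frac{\dot\gamma\times\ddot\gamma\times\dddot\gamma}{|\dot\gamma\times\ddot\gamma\times\dddot\gamma|},\quad \mathbf{n}_2=-\mathbf{n}_3\times\mathbf{t}\times\mathbf{n}_1,$$ and its curvatures $\kappa_1>0$, $\kappa_2>0$, $\kappa_3$ are determined by $\dot{\mathbf{t}}=|\dot\gamma|\kappa_1\mathbf{n}_1$, $\dot{\mathbf{n}}_1=|\dot\gamma|(-\kappa_1\mathbf{t}+\kappa_2\mathbf{n}_2)$, $\dot{\mathbf{n}}_2=|\dot\gamma|(-\kappa_2\mathbf{n}_1+\kappa_3\mathbf{n}_3)$, $\dot{\mathbf{n}}_3=-|\dot\gamma|\kappa_3\mathbf{n}_2$.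 Objects of $\overline\gamma$ (computed with the same parameter, which need not be arc-length for $\overline\gamma$) are denoted with a bar. Definition. Different non-degenerate curves $\gamma,\overline\gamma:I\to\mathbb{R}^4$ are third mates (third type of Mannheim mates) if there is a smooth function $\lambda:I\to\mathbb{R}$ with $\overline\gamma(t)=\gamma(t)+\lambda(t)\mathbf{n}_1(t)$ and $\mathbf{n}_1(t)=\pm\overline{\mathbf{n}}_3(t)$ for all $t\in I$. *)

theory Defs
  imports "HOL-Analysis.Analysis"
begin

text \<open>The derivative is taken within \<open>I\<close>, so it is one-sided at an endpoint belonging to \<open>I\<close>.\<close>

definition deriv_in :: "real set \<Rightarrow> (real \<Rightarrow> 'a::real_normed_vector) \<Rightarrow> real \<Rightarrow> 'a" where
  "deriv_in I f = (\<lambda>t. vector_derivative f (at t within I))"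

definition smooth_in :: "real set \<Rightarrow> (real \<Rightarrow> 'a::real_normed_vector) \<Rightarrow> bool" where
  "smooth_in I f \<longleftrightarrow>
     (\<forall>k. \<forall>t\<in>I. ((deriv_in I ^^ k) f) differentiable (at t within I))"

definition vector_prod :: "real^4 \<Rightarrow> real^4 \<Rightarrow> real^4 \<Rightarrow> real^4" where
  "vector_prod a b c = (THE v. \<forall>x. v \<bullet> x = det (vector [a, b, c, x] :: real^4^4))"

lemma vector_4_rows:
  fixes a b c x :: "real^4"
  shows "(vector [a, b, c, x] :: real^4^4)
    = (\<chi> i. if i = 4 then x else if i = 1 then a else if i = 2 then b else c)"
  unfolding vector_def vec_eq_iff forall_4 by simp

lemma vector_prod_inner: "vector_prod a b c \<bullet> x = det (vector [a, b, c, x] :: real^4^4)"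
proof -
  define f :: "real^4 \<Rightarrow> real" where "f = (\<lambda>x. det (vector [a, b, c, x] :: real^4^4))"
  have "linear f"
    unfolding f_def vector_4_rows
    by (rule linearI)
      (simp_all add: det_row_add[where k = 4, symmetric]
        det_row_mul[where 'a = real and k = 4, unfolded scalar_mult_eq_scaleR, symmetric])
  then have "\<forall>x. adjoint f 1 \<bullet> x = f x"
    using adjoint_clauses(2)[of f 1] by simp
  moreover have "v = w" if "\<forall>x. v \<bullet> x = f x" "\<forall>x. w \<bullet> x = f x" for v w
    using that by (metis vector_eq_rdot)
  ultimately have "\<exists>!v. \<forall>x. v \<bullet> x = f x"
    by blast
  from theI'[OF this] show ?thesis
    unfolding vector_prod_def f_def by blast
qed

definition regular_curve :: "real set \<Rightarrow> (real \<Rightarrow> real^4) \<Rightarrow> bool" where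
  "regular_curve I \<gamma> \<longleftrightarrow> smooth_in I \<gamma> \<and> (\<forall>t\<in>I. deriv_in I \<gamma> t \<noteq> 0)"

definition osc_normal :: "real set \<Rightarrow> (real \<Rightarrow> real^4) \<Rightarrow> real \<Rightarrow> real^4" where
  "osc_normal I \<gamma> t =
     vector_prod (deriv_in I \<gamma> t) ((deriv_in I ^^ 2) \<gamma> t) ((deriv_in I ^^ 3) \<gamma> t)"

definition nondegenerate_curve :: "real set \<Rightarrow> (real \<Rightarrow> real^4) \<Rightarrow> bool" where
  "nondegenerate_curve I \<gamma> \<longleftrightarrow> regular_curve I \<gamma> \<and> (\<forall>t\<in>I. osc_normal I \<gamma> t \<noteq> 0)"

definition arclength_parametrized :: "real set \<Rightarrow> (real \<Rightarrow> real^4) \<Rightarrow> bool" where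
  "arclength_parametrized I \<gamma> \<longleftrightarrow> (\<forall>t\<in>I. norm (deriv_in I \<gamma> t) = 1)"

definition frenet_t :: "real set \<Rightarrow> (real \<Rightarrow> real^4) \<Rightarrow> real \<Rightarrow> real^4" where
  "frenet_t I \<gamma> t = deriv_in I \<gamma> t /\<^sub>R norm (deriv_in I \<gamma> t)"

definition frenet_n1 :: "real set \<Rightarrow> (real \<Rightarrow> real^4) \<Rightarrow> real \<Rightarrow> real^4" where
  "frenet_n1 I \<gamma> t = deriv_in I (frenet_t I \<gamma>) t /\<^sub>R norm (deriv_in I (frenet_t I \<gamma>) t)"

definition frenet_n3 :: "real set \<Rightarrow> (real \<Rightarrow> real^4) \<Rightarrow> real \<Rightarrow> real^4" where
  "frenet_n3 I \<gamma> t = osc_normal I \<gamma> t /\<^sub>R norm (osc_normal I \<gamma> t)"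

definition frenet_n2 :: "real set \<Rightarrow> (real \<Rightarrow> real^4) \<Rightarrow> real \<Rightarrow> real^4" where
  "frenet_n2 I \<gamma> t = - vector_prod (frenet_n3 I \<gamma> t) (frenet_t I \<gamma> t) (frenet_n1 I \<gamma> t)"

definition frenet_equations ::
    "real set \<Rightarrow> (real \<Rightarrow> real^4) \<Rightarrow> real \<Rightarrow> real \<Rightarrow> real \<Rightarrow> real \<Rightarrow> bool" where
  "frenet_equations I \<gamma> t k1 k2 k3 \<longleftrightarrow>
     k1 > 0 \<and> k2 > 0 \<and>
     deriv_in I (frenet_t I \<gamma>) t =
       norm (deriv_in I \<gamma> t) *\<^sub>R (k1 *\<^sub>R frenet_n1 I \<gamma> t) \<and>
     deriv_in I (frenet_n1 I \<gamma>) t =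
       norm (deriv_in I \<gamma> t) *\<^sub>R (- k1 *\<^sub>R frenet_t I \<gamma> t + k2 *\<^sub>R frenet_n2 I \<gamma> t) \<and>
     deriv_in I (frenet_n2 I \<gamma>) t =
       norm (deriv_in I \<gamma> t) *\<^sub>R (- k2 *\<^sub>R frenet_n1 I \<gamma> t + k3 *\<^sub>R frenet_n3 I \<gamma> t) \<and>
     deriv_in I (frenet_n3 I \<gamma>) t =
       - (norm (deriv_in I \<gamma> t) *\<^sub>R (k3 *\<^sub>R frenet_n2 I \<gamma> t))"

text \<open>For a non-degenerate curve on a non-degenerate interval the Frenet equations have exactly
  one solution at every parameter, so the descriptions below are then meaningful.\<close>

definition curvature1 :: "real set \<Rightarrow> (real \<Rightarrow> real^4) \<Rightarrow> real \<Rightarrow> real" where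
  "curvature1 I \<gamma> t = (THE k1. \<exists>k2 k3. frenet_equations I \<gamma> t k1 k2 k3)"

definition curvature2 :: "real set \<Rightarrow> (real \<Rightarrow> real^4) \<Rightarrow> real \<Rightarrow> real" where
  "curvature2 I \<gamma> t = (THE k2. \<exists>k1 k3. frenet_equations I \<gamma> t k1 k2 k3)"

definition curvature3 :: "real set \<Rightarrow> (real \<Rightarrow> real^4) \<Rightarrow> real \<Rightarrow> real" where
  "curvature3 I \<gamma> t = (THE k3. \<exists>k1 k2. frenet_equations I \<gamma> t k1 k2 k3)"

definition third_mates :: "real set \<Rightarrow> (real \<Rightarrow> real^4) \<Rightarrow> (real \<Rightarrow> real^4) \<Rightarrow> bool" where
  "third_mates I \<gamma> \<delta> \<longleftrightarrow>
     nondegenerate_curve I \<gamma> \<and> nondegenerate_curve I \<delta> \<and> (\<exists>t\<in>I. \<gamma> t \<noteq> \<delta> t) \<and>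
     (\<exists>l. smooth_in I l \<and>
       (\<forall>t\<in>I. \<delta> t = \<gamma> t + l t *\<^sub>R frenet_n1 I \<gamma> t) \<and>
       (\<forall>t\<in>I. frenet_n1 I \<gamma> t = frenet_n3 I \<delta> t \<or> frenet_n1 I \<gamma> t = - frenet_n3 I \<delta> t))"

end

theory Submission
  imports Defs
begin

text \<open>
  Write \<open>T, N1, N2, N3\<close> for the Frenet frame of the unit-speed curve \<open>\<gamma>\<close>, \<open>\<delta> = \<gamma> + l N1\<close> for the
  offset curve and primes for derivatives. By the second Frenet equation
  \<open>N1' = - \<kappa>1 T + \<kappa>2 N2\<close>, so that \<open>T \<bullet> N1' = - \<kappa>1\<close> and \<open>N1' \<bullet> N1' = \<kappa>1\<^sup>2 + \<kappa>2\<^sup>2\<close>, while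
  \<open>\<delta>' = T + l N1'\<close> and \<open>\<delta>'' = \<kappa>1 N1 + l N1''\<close>.

  If \<open>N1\<close> is, up to sign, the third normal of \<open>\<delta>\<close>, it is orthogonal to \<open>\<delta>'\<close>, \<open>\<delta>''\<close> and \<open>\<delta>'''\<close>.
  Differentiating the first two of these orthogonalities shows that \<open>N1'\<close> is orthogonal to \<open>\<delta>'\<close> and
  to \<open>\<delta>''\<close>. The first fact reads \<open>l (\<kappa>1\<^sup>2 + \<kappa>2\<^sup>2) = \<kappa>1\<close>. Since \<open>N1 \<bullet> N1' = 0\<close>, the second one
  reads \<open>N1' \<bullet> N1'' = 0\<close>, so \<open>\<kappa>1\<^sup>2 + \<kappa>2\<^sup>2\<close> is constant; then \<open>\<kappa>1\<close> is constant by the first relation,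
  and so is \<open>\<kappa>2 > 0\<close>. This is \<open>offset_orthogonal_imp_constant_curvatures\<close>. The argument
  differentiates \<open>N1'\<close>, which is as regular as \<open>\<delta>'\<close>, rather than the curvatures.

  For constant curvatures related in this way, the \<open>N1\<close>-component of \<open>\<delta>''\<close> cancels:
  \<open>\<delta>' = (1 - l \<kappa>1) T + l \<kappa>2 N2\<close> and \<open>\<delta>'' = l \<kappa>2 \<kappa>3 N3\<close>
  (\<open>offset_derivatives_of_constant_curvatures\<close>). A zero of \<open>\<kappa>3\<close> would therefore make \<open>\<delta>\<close> degenerate,
  which completes one direction. Conversely, \<open>\<delta>'\<close>, \<open>\<delta>''\<close> and \<open>\<delta>'''\<close> all lie in the span of
  \<open>T, N2, N3\<close>, so their vector product is a multiple of \<open>N1\<close>, with coefficient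
  \<open>(1 - l \<kappa>1) (l \<kappa>2)\<^sup>2 \<kappa>3\<^sup>3\<close> up to sign; this is nonzero when \<open>\<kappa>3\<close> is, because the relation
  between the constants gives \<open>(1 - l \<kappa>1) \<kappa>1 = l \<kappa>2\<^sup>2\<close> (\<open>third_mates_offset\<close>).

  All this rests on the Frenet equations for the frame and the curvatures as they are defined. The
  vector product of three orthonormal vectors is a unit vector orthogonal to them, hence the frame
  is orthonormal; expanding the derivatives of its members in the frame gives the equations, with
  \<open>\<kappa>2\<close> positive because it equals \<open>norm (osc_normal I \<gamma> s) / norm (\<gamma>'' s)\<^sup>2\<close>.
\<close>

section \<open>The ternary vector product\<close>

text \<open>Antisymmetry in all four arguments of \<open>vector_prod a b c \<bullet> x\<close> is that of the determinant under
  row transpositions. Linearity in each slot then follows by moving that slot to the place of \<open>x\<close>,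
  where it is the linearity of the inner product.\<close>

lemma vector_prod_swap12: "vector_prod b a c = - vector_prod a b c"
proof -
  have "vector_prod b a c \<bullet> x = (- vector_prod a b c) \<bullet> x" for x
  proof -
    have rows: "(vector [b, a, c, x] :: real^4^4)
        = (\<chi> i. (vector [a, b, c, x] :: real^4^4) $ Transposition.transpose 1 2 i)"
      unfolding vector_4_rows vec_eq_iff forall_4 by (simp add: Transposition.transpose_def)
    show ?thesis
      unfolding vector_prod_inner inner_minus_left rows
      by (subst det_permute_rows) (auto simp: permutes_swap_id sign_swap_id)
  qed
  then show ?thesis
    by (metis vector_eq_rdot)
qed

lemma vector_prod_swap23: "vector_prod a c b = - vector_prod a b c"
proof -
  have "vector_prod a c b \<bullet> x = (- vector_prod a b c) \<bullet> x" for x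
  proof -
    have rows: "(vector [a, c, b, x] :: real^4^4)
        = (\<chi> i. (vector [a, b, c, x] :: real^4^4) $ Transposition.transpose 2 3 i)"
      unfolding vector_4_rows vec_eq_iff forall_4 by (simp add: Transposition.transpose_def)
    show ?thesis
      unfolding vector_prod_inner inner_minus_left rows
      by (subst det_permute_rows) (auto simp: permutes_swap_id sign_swap_id)
  qed
  then show ?thesis
    by (metis vector_eq_rdot)
qed

lemma vector_prod_swap34: "vector_prod a b x \<bullet> c = - (vector_prod a b c \<bullet> x)"
proof -
  have rows: "(vector [a, b, x, c] :: real^4^4)
      = (\<chi> i. (vector [a, b, c, x] :: real^4^4) $ Transposition.transpose 3 4 i)"
    unfolding vector_4_rows vec_eq_iff forall_4 by (simp add: Transposition.transpose_def)
  show ?thesis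
    unfolding vector_prod_inner rows
    by (subst det_permute_rows) (auto simp: permutes_swap_id sign_swap_id)
qed

lemma vector_prod_add3: "vector_prod a b (c + c') = vector_prod a b c + vector_prod a b c'"
proof -
  have "vector_prod a b (c + c') \<bullet> x = (vector_prod a b c + vector_prod a b c') \<bullet> x" for x
    by (simp add: vector_prod_swap34[of a b _ x] inner_add_left inner_add_right)
  then show ?thesis
    by (metis vector_eq_rdot)
qed

lemma vector_prod_scaleR3: "vector_prod a b (k *\<^sub>R c) = k *\<^sub>R vector_prod a b c"
proof -
  have "vector_prod a b (k *\<^sub>R c) \<bullet> x = (k *\<^sub>R vector_prod a b c) \<bullet> x" for x
    by (simp add: vector_prod_swap34[of a b _ x])
  then show ?thesis
    by (metis vector_eq_rdot)
qed

lemma vector_prod_add2: "vector_prod a (b + b') c = vector_prod a b c + vector_prod a b' c"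
  by (simp add: vector_prod_swap23[of a _ c] vector_prod_add3)

lemma vector_prod_scaleR2: "vector_prod a (k *\<^sub>R b) c = k *\<^sub>R vector_prod a b c"
  by (simp add: vector_prod_swap23[of a _ c] vector_prod_scaleR3)

lemma vector_prod_add1: "vector_prod (a + a') b c = vector_prod a b c + vector_prod a' b c"
  by (simp add: vector_prod_swap12[of _ b] vector_prod_add2)

lemma vector_prod_scaleR1: "vector_prod (k *\<^sub>R a) b c = k *\<^sub>R vector_prod a b c"
  by (simp add: vector_prod_swap12[of _ b] vector_prod_scaleR2)

lemmas vector_prod_trilinear =
  vector_prod_add1 vector_prod_add2 vector_prod_add3
  vector_prod_scaleR1 vector_prod_scaleR2 vector_prod_scaleR3

lemma vector_prod_same12 [simp]: "vector_prod a a c = 0"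
  using vector_prod_swap12[of a a c] by (simp add: vec_eq_iff)

lemma vector_prod_same23 [simp]: "vector_prod a b b = 0"
  using vector_prod_swap23[of a b b] by (simp add: vec_eq_iff)

lemma vector_prod_same13 [simp]: "vector_prod a b a = 0"
  using vector_prod_swap23[of a b a] by simp

lemma vector_prod_zero2 [simp]: "vector_prod a 0 c = 0"
  using vector_prod_scaleR2[of a 0 0 c] by simp

lemma vector_prod_orthogonal [simp]:
  "vector_prod a b c \<bullet> a = 0" "vector_prod a b c \<bullet> b = 0" "vector_prod a b c \<bullet> c = 0"
  using vector_prod_swap34[of a b c a] vector_prod_swap34[of a b c b]
    vector_prod_swap34[of a b c c] by simp_all

lemmas orthogonal_vector_prod [simp] = vector_prod_orthogonal[THEN trans[OF inner_commute]]

text \<open>For the matrix \<open>M\<close> with rows \<open>a, b, c, x\<close>, the Gram matrix \<open>M ** transpose M\<close> is diagonal with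
  entries \<open>1, 1, 1, x \<bullet> x\<close>, and its determinant is \<open>(det M)\<^sup>2\<close>.\<close>

lemma vector_prod_inner_sq:
  assumes "norm a = 1" "norm b = 1" "norm c = 1" "a \<bullet> b = 0" "a \<bullet> c = 0" "b \<bullet> c = 0"
    and "a \<bullet> x = 0" "b \<bullet> x = 0" "c \<bullet> x = 0"
  shows "(vector_prod a b c \<bullet> x)\<^sup>2 = x \<bullet> x"
proof -
  define M :: "real^4^4" where "M = vector [a, b, c, x]"
  have gram: "(M ** Finite_Cartesian_Product.transpose M) $ i $ j = M $ i \<bullet> M $ j" for i j
    by (simp add: matrix_matrix_mult_def Finite_Cartesian_Product.transpose_def inner_vec_def)
  have unit: "a \<bullet> a = 1" "b \<bullet> b = 1" "c \<bullet> c = 1"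
    using assms(1-3) by (simp_all add: norm_eq_1)
  have rows: "M $ 1 = a" "M $ 2 = b" "M $ 3 = c" "M $ 4 = x"
    unfolding M_def vector_4_rows by simp_all
  have "\<forall>i j. i \<noteq> j \<longrightarrow> M $ i \<bullet> M $ j = 0"
    unfolding forall_4 using assms by (simp add: rows inner_commute)
  then have "det (M ** Finite_Cartesian_Product.transpose M) = (\<Prod>i\<in>UNIV. M $ i \<bullet> M $ i)"
    by (subst det_diagonal) (simp_all add: gram)
  also have "\<dots> = x \<bullet> x"
    unfolding UNIV_4 by (simp add: rows unit)
  finally show ?thesis
    by (simp add: det_mul vector_prod_inner M_def power2_eq_square)
qed

text \<open>Applied to \<open>v = vector_prod a b c\<close> itself, the preceding lemma gives \<open>(v \<bullet> v)\<^sup>2 = v \<bullet> v\<close>, so the norm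
  of \<open>v\<close> is 0 or 1. Applied to any nonzero vector orthogonal to \<open>a\<close>, \<open>b\<close> and \<open>c\<close>, which exists by
  counting dimensions, it excludes \<open>v = 0\<close>.\<close>

lemma norm_vector_prod_orthonormal:
  assumes "norm a = 1" "norm b = 1" "norm c = 1" "a \<bullet> b = 0" "a \<bullet> c = 0" "b \<bullet> c = 0"
  shows "norm (vector_prod a b c) = 1"
proof -
  let ?v = "vector_prod a b c"
  have "dim {a, b, c} \<le> card {a, b, c}"
    by (rule dim_le_card) (auto intro: span_base)
  also have "\<dots> \<le> 3"
    by (simp add: card_insert_if)
  finally have "dim {a, b, c} < DIM(real^4)"
    by simp
  then obtain u where u: "u \<noteq> 0" and ortho: "\<And>y. y \<in> span {a, b, c} \<Longrightarrow> orthogonal u y"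
    using orthogonal_to_subspace_exists by metis
  have "a \<bullet> u = 0" "b \<bullet> u = 0" "c \<bullet> u = 0"
    using ortho[of a] ortho[of b] ortho[of c]
    by (simp_all add: span_base orthogonal_def inner_commute)
  then have "(?v \<bullet> u)\<^sup>2 = u \<bullet> u"
    by (rule vector_prod_inner_sq[OF assms])
  with u have "?v \<noteq> 0"
    by auto
  moreover have "(?v \<bullet> ?v)\<^sup>2 = ?v \<bullet> ?v"
    by (rule vector_prod_inner_sq[OF assms]) simp_all
  ultimately show ?thesis
    by (simp add: norm_eq_1 power2_eq_square)
qed

lemma orthonormal_frame_expand:
  fixes x :: "real^4"
  assumes unit: "norm a = 1" "norm b = 1" "norm c = 1" "norm d = 1"
    and ortho: "a \<bullet> b = 0" "a \<bullet> c = 0" "a \<bullet> d = 0" "b \<bullet> c = 0" "b \<bullet> d = 0" "c \<bullet> d = 0"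
  shows "x = (x \<bullet> a) *\<^sub>R a + (x \<bullet> b) *\<^sub>R b + (x \<bullet> c) *\<^sub>R c + (x \<bullet> d) *\<^sub>R d"
proof -
  have distinct: "a \<noteq> b" "a \<noteq> c" "a \<noteq> d" "b \<noteq> c" "b \<noteq> d" "c \<noteq> d"
    using assms by auto
  let ?B = "{a, b, c, d}"
  have pair: "pairwise orthogonal ?B"
    using ortho by (auto simp: pairwise_def orthogonal_def inner_commute)
  moreover have "0 \<notin> ?B"
    using unit by auto
  ultimately have "independent ?B"
    by (rule pairwise_orthogonal_independent)
  moreover have "card ?B = dim (UNIV :: (real^4) set)"
    using distinct by simp
  ultimately have "UNIV \<subseteq> span ?B"
    by (subst card_eq_dim[symmetric]) auto
  then have "(\<Sum>e\<in>?B. (x \<bullet> e) *\<^sub>R e) = x"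
    by (intro orthonormal_basis_expand pair) (use unit in auto)
  then show ?thesis
    using distinct by (simp add: add.assoc)
qed

text \<open>Each component of the vector product is a determinant, hence a polynomial in the entries.\<close>

lemma differentiable_vector_prod:
  fixes f g h :: "real \<Rightarrow> real^4"
  assumes "f differentiable (at t within S)" "g differentiable (at t within S)"
    "h differentiable (at t within S)"
  shows "(\<lambda>s. vector_prod (f s) (g s) (h s)) differentiable (at t within S)"
proof -
  have "(\<lambda>s. vector_prod (f s) (g s) (h s) \<bullet> e) differentiable (at t within S)" for e
  proof -
    have row: "(\<lambda>s. (vector [f s, g s, h s, e] :: real^4^4) $ i $ j) differentiable (at t within S)"
      for i j
      unfolding vector_4_rows using assms
      by (cases "i = 4"; cases "i = 1"; cases "i = 2") (simp_all add: cart_eq_inner_axis)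
    let ?M = "\<lambda>s. vector [f s, g s, h s, e] :: real^4^4"
    have "(\<lambda>s. of_int (sign p) * (\<Prod>i\<in>UNIV. ?M s $ i $ p i)) differentiable (at t within S)" for p
      using has_derivative_prod[where I = UNIV and f = "\<lambda>i s. ?M s $ i $ p i",
          OF row[unfolded frechet_derivative_works]]
      by (intro differentiable_mult differentiable_const) (auto simp: differentiable_def)
    then show ?thesis
      unfolding vector_prod_inner det_def by (intro differentiable_sum) auto
  qed
  then show ?thesis
    by (subst differentiable_componentwise_within) blast
qed

lemma differentiable_normalize:
  fixes f :: "real \<Rightarrow> 'a::real_inner"
  assumes "f differentiable (at t within S)" "f t \<noteq> 0"
  shows "(\<lambda>s. f s /\<^sub>R norm (f s)) differentiable (at t within S)"
proof -
  have "(\<lambda>s. norm (f s)) differentiable (at t within S)"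
    using assms by (intro differentiable_compose[of norm f] differentiable_norm_at)
  then have "(\<lambda>s. inverse (norm (f s))) differentiable (at t within S)"
    using assms(2) by (intro differentiable_inverse) simp_all
  then show ?thesis
    using assms(1) by (rule differentiable_scaleR)
qed

section \<open>Differentiation within an interval\<close>

locale nontrivial_interval =
  fixes I :: "real set"
  assumes interval: "is_interval I" and interior_nonempty: "interior I \<noteq> {}"
begin

text \<open>Every point of a nontrivial interval is a limit point of it, endpoints included; this makes
  derivatives within the interval unique.\<close>

lemma at_within_nontrivial:
  assumes "s \<in> I"
  shows "at s within I \<noteq> bot"
proof -
  have "I \<noteq> {x}" for x
    using interior_nonempty by (metis interior_singleton)
  then have "s islimpt I"
    using assms interval is_interval_connected connected_imp_perfect by blast
  then show ?thesis
    by (simp add: trivial_limit_within)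
qed

lemma deriv_in_eq:
  assumes "s \<in> I" "(f has_vector_derivative D) (at s within I)"
  shows "deriv_in I f s = D"
  unfolding deriv_in_def using assms by (intro vector_derivative_within at_within_nontrivial)

lemma has_vector_derivative_deriv_in:
  assumes "f differentiable (at s within I)"
  shows "(f has_vector_derivative deriv_in I f s) (at s within I)"
  unfolding deriv_in_def using assms by (simp add: vector_derivative_works)

lemma has_vector_derivative_cong_on:
  assumes "\<And>u. u \<in> I \<Longrightarrow> f u = g u" "s \<in> I"
  shows "(f has_vector_derivative D) (at s within I) \<longleftrightarrow> (g has_vector_derivative D) (at s within I)"
  using assms has_vector_derivative_transform[of s I f g D] has_vector_derivative_transform[of s I g f D]
  by auto

text \<open>The product rule for a constant inner product, used to read off one frame coefficient of a
  derivative from another.\<close>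

lemma inner_constant_derivative:
  fixes f g :: "real \<Rightarrow> 'b::real_inner"
  assumes s: "s \<in> I" and const: "\<And>u. u \<in> I \<Longrightarrow> f u \<bullet> g u = c"
    and f: "(f has_vector_derivative f') (at s within I)"
    and g: "(g has_vector_derivative g') (at s within I)"
  shows "f' \<bullet> g s = - (f s \<bullet> g')"
proof -
  have "((\<lambda>u. f u \<bullet> g u) has_vector_derivative (f s \<bullet> g' + f' \<bullet> g s)) (at s within I)"
    by (rule bounded_bilinear.has_vector_derivative[OF bounded_bilinear_inner f g])
  moreover have "((\<lambda>u. f u \<bullet> g u) has_vector_derivative 0) (at s within I)"
    using has_vector_derivative_cong_on[OF const s] by simp
  ultimately have "f s \<bullet> g' + f' \<bullet> g s = 0"
    by (rule vector_derivative_unique_within[OF at_within_nontrivial[OF s]])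
  then show ?thesis
    by simp
qed

lemma smooth_in_iterated_derivative:
  assumes "smooth_in I f" "s \<in> I"
  shows "((deriv_in I ^^ k) f has_vector_derivative (deriv_in I ^^ Suc k) f s) (at s within I)"
  using assms unfolding smooth_in_def by (simp add: has_vector_derivative_deriv_in)

text \<open>Used to see that \<open>\<gamma> + l N1\<close> is smooth when \<open>\<kappa>1\<close> is constant: then \<open>N1\<close> is a constant multiple of
  the second derivative of \<open>\<gamma>\<close>.\<close>

lemma smooth_in_add_scaleR_derivative:
  assumes f: "smooth_in I f" and g: "\<And>u. u \<in> I \<Longrightarrow> g u = f u + c *\<^sub>R (deriv_in I ^^ m) f u"
  shows "smooth_in I g"
proof -
  let ?h = "\<lambda>k u. (deriv_in I ^^ k) f u + c *\<^sub>R (deriv_in I ^^ (k + m)) f u"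
  have h: "(?h k has_vector_derivative ?h (Suc k) u) (at u within I)" if "u \<in> I" for k u
    using smooth_in_iterated_derivative[OF f that, of k]
      smooth_in_iterated_derivative[OF f that, of "k + m"]
    by (auto intro!: derivative_eq_intros)
  have eq: "(deriv_in I ^^ k) g u = ?h k u" if "u \<in> I" for k u
    using that
  proof (induction k arbitrary: u)
    case (Suc k)
    have "((deriv_in I ^^ k) g has_vector_derivative ?h (Suc k) u) (at u within I)"
      using h[OF Suc.prems, of k] has_vector_derivative_cong_on[of "(deriv_in I ^^ k) g" "?h k", OF Suc.IH Suc.prems]
      by blast
    then show ?case
      using deriv_in_eq[OF Suc.prems] by simp
  qed (simp add: g)
  show ?thesis
    unfolding smooth_in_def
  proof (intro allI ballI)
    fix k t assume "t \<in> I"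
    then have "((deriv_in I ^^ k) g has_vector_derivative ?h (Suc k) t) (at t within I)"
      using h[of t k] has_vector_derivative_cong_on[of "(deriv_in I ^^ k) g" "?h k" t, OF eq] by blast
    then show "(deriv_in I ^^ k) g differentiable (at t within I)"
      by (auto simp: differentiable_def has_vector_derivative_def)
  qed
qed

lemma smooth_in_const: "smooth_in I (\<lambda>_. c)"
proof -
  have "(deriv_in I ^^ k) (\<lambda>_. c) u = (if k = 0 then c else 0)" if "u \<in> I" for k u
    using that
  proof (induction k arbitrary: u)
    case (Suc k)
    have "((deriv_in I ^^ k) (\<lambda>_. c) has_vector_derivative 0) (at u within I)"
      using has_vector_derivative_cong_on[OF Suc.IH Suc.prems]
      by (simp add: has_vector_derivative_const)
    then show ?case
      using deriv_in_eq[OF Suc.prems] by simp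
  qed simp
  then have "((deriv_in I ^^ k) (\<lambda>_. c) has_vector_derivative 0) (at u within I)" if "u \<in> I" for k u
    using has_vector_derivative_cong_on[OF _ that, of _ "\<lambda>_. if k = 0 then c else 0"] that
    by (simp add: has_vector_derivative_const)
  then show ?thesis
    unfolding smooth_in_def differentiable_def has_vector_derivative_def by blast
qed

end

section \<open>The Frenet frame of a unit-speed curve\<close>

locale unit_speed_curve = nontrivial_interval +
  fixes \<gamma> :: "real \<Rightarrow> real^4"
  assumes nondegenerate: "nondegenerate_curve I \<gamma>"
    and arclength: "arclength_parametrized I \<gamma>"
begin

abbreviation "T \<equiv> frenet_t I \<gamma>"
abbreviation "N1 \<equiv> frenet_n1 I \<gamma>"
abbreviation "N2 \<equiv> frenet_n2 I \<gamma>"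
abbreviation "N3 \<equiv> frenet_n3 I \<gamma>"
abbreviation "\<kappa>1 \<equiv> curvature1 I \<gamma>"
abbreviation "\<kappa>2 \<equiv> curvature2 I \<gamma>"
abbreviation "\<kappa>3 \<equiv> curvature3 I \<gamma>"
text \<open>The \<open>k\<close>-th derivative within \<open>I\<close>; \<open>T\<close> agrees with \<open>D 1\<close> on \<open>I\<close> only.\<close>

abbreviation "D k \<equiv> (deriv_in I ^^ k) \<gamma>"

lemma smooth: "smooth_in I \<gamma>"
  using nondegenerate by (simp add: nondegenerate_curve_def regular_curve_def)

lemma derivative_D:
  "s \<in> I \<Longrightarrow> (D k has_vector_derivative D (Suc k) s) (at s within I)"
  using smooth_in_iterated_derivative[OF smooth] .

lemma differentiable_D: "s \<in> I \<Longrightarrow> D k differentiable (at s within I)"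
  using smooth by (simp add: smooth_in_def)

lemma osc_normal_D: "osc_normal I \<gamma> s = vector_prod (D 1 s) (D 2 s) (D 3 s)"
  by (simp add: osc_normal_def)

lemma osc_normal_nonzero: "s \<in> I \<Longrightarrow> osc_normal I \<gamma> s \<noteq> 0"
  using nondegenerate by (simp add: nondegenerate_curve_def)

lemma D2_nonzero: "s \<in> I \<Longrightarrow> D 2 s \<noteq> 0"
  using osc_normal_nonzero[of s] by (auto simp: osc_normal_D)

lemma speed: "s \<in> I \<Longrightarrow> norm (deriv_in I \<gamma> s) = 1"
  using arclength by (simp add: arclength_parametrized_def)

lemma T_eq: "s \<in> I \<Longrightarrow> T s = D 1 s"
  by (simp add: frenet_t_def speed)

lemma T_deriv: "s \<in> I \<Longrightarrow> (T has_vector_derivative D 2 s) (at s within I)"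
  using has_vector_derivative_cong_on[of T "D 1" s, OF T_eq] derivative_D[of s 1]
  by (simp add: numeral_2_eq_2)

lemma N1_eq: "s \<in> I \<Longrightarrow> N1 s = D 2 s /\<^sub>R norm (D 2 s)"
  unfolding frenet_n1_def using deriv_in_eq[OF _ T_deriv] by simp

lemma D2_eq: "s \<in> I \<Longrightarrow> D 2 s = norm (D 2 s) *\<^sub>R N1 s"
  using D2_nonzero[of s] by (simp add: N1_eq)

lemma norm_frame:
  assumes "s \<in> I"
  shows "norm (T s) = 1" "norm (N1 s) = 1" "norm (N3 s) = 1"
  using speed[OF assms] D2_nonzero[OF assms] osc_normal_nonzero[OF assms]
  by (simp_all add: T_eq N1_eq frenet_n3_def assms)

lemma T_orthogonal_N1: "s \<in> I \<Longrightarrow> T s \<bullet> N1 s = 0"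
proof -
  assume s: "s \<in> I"
  have "T u \<bullet> T u = 1" if "u \<in> I" for u
    using norm_frame(1)[OF that] by (simp add: norm_eq_1)
  from inner_constant_derivative[OF s this T_deriv[OF s] T_deriv[OF s]]
  have "T s \<bullet> D 2 s = 0"
    by (simp add: inner_commute)
  then show ?thesis
    by (simp add: N1_eq s)
qed

lemma N3_orthogonal:
  assumes "s \<in> I"
  shows "T s \<bullet> N3 s = 0" "N1 s \<bullet> N3 s = 0" "D 3 s \<bullet> N3 s = 0"
  by (simp_all add: assms T_eq N1_eq frenet_n3_def osc_normal_D del: funpow.simps One_nat_def)

lemma N2_orthonormal:
  assumes "s \<in> I"
  shows "norm (N2 s) = 1" "T s \<bullet> N2 s = 0" "N1 s \<bullet> N2 s = 0" "N2 s \<bullet> N3 s = 0"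
  using norm_frame[OF assms] T_orthogonal_N1[OF assms] N3_orthogonal[OF assms]
    norm_vector_prod_orthonormal[of "N3 s" "T s" "N1 s"]
  by (simp_all add: frenet_n2_def inner_commute[of "N3 s"])

lemmas frame_unit = norm_frame N2_orthonormal(1)
lemmas frame_orthogonal = T_orthogonal_N1 N3_orthogonal(1,2) N2_orthonormal(2-4)

text \<open>The orthonormality relations with both orders of the factors, as rewrite rules.\<close>

lemma frame_inner:
  assumes "s \<in> I"
  shows "T s \<bullet> T s = 1" "N1 s \<bullet> N1 s = 1" "N2 s \<bullet> N2 s = 1" "N3 s \<bullet> N3 s = 1"
    "T s \<bullet> N1 s = 0" "T s \<bullet> N2 s = 0" "T s \<bullet> N3 s = 0"
    "N1 s \<bullet> N2 s = 0" "N1 s \<bullet> N3 s = 0" "N2 s \<bullet> N3 s = 0"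
    "N1 s \<bullet> T s = 0" "N2 s \<bullet> T s = 0" "N3 s \<bullet> T s = 0"
    "N2 s \<bullet> N1 s = 0" "N3 s \<bullet> N1 s = 0" "N3 s \<bullet> N2 s = 0"
  using frame_unit[OF assms] frame_orthogonal[OF assms] by (simp_all add: norm_eq_1 inner_commute)

lemma frame_expand:
  assumes "s \<in> I"
  shows "x = (x \<bullet> T s) *\<^sub>R T s + (x \<bullet> N1 s) *\<^sub>R N1 s + (x \<bullet> N2 s) *\<^sub>R N2 s + (x \<bullet> N3 s) *\<^sub>R N3 s"
  by (rule orthonormal_frame_expand) (use frame_unit[OF assms] frame_orthogonal[OF assms] in auto)

lemma frame_differentiable:
  assumes s: "s \<in> I"
  shows "N1 differentiable (at s within I)" "N3 differentiable (at s within I)"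
    "N2 differentiable (at s within I)"
proof -
  have "(\<lambda>u. D 2 u /\<^sub>R norm (D 2 u)) differentiable (at s within I)"
    by (rule differentiable_normalize[OF differentiable_D[OF s] D2_nonzero[OF s]])
  then show N1: "N1 differentiable (at s within I)"
    by (rule differentiable_transform_within[where d = 1]) (use s in \<open>simp_all add: N1_eq\<close>)
  have "osc_normal I \<gamma> differentiable (at s within I)"
    unfolding osc_normal_D[abs_def] by (intro differentiable_vector_prod differentiable_D s)
  then show N3: "N3 differentiable (at s within I)"
    unfolding frenet_n3_def[abs_def] by (rule differentiable_normalize) (rule osc_normal_nonzero[OF s])
  have "T differentiable (at s within I)"
    using T_deriv[OF s] by (auto simp: differentiable_def has_vector_derivative_def)
  then show "N2 differentiable (at s within I)"
    unfolding frenet_n2_def[abs_def] using N1 N3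
    by (intro differentiable_minus differentiable_vector_prod)
qed

lemmas N1_deriv = has_vector_derivative_deriv_in[OF frame_differentiable(1)]
  and N2_deriv = has_vector_derivative_deriv_in[OF frame_differentiable(3)]
  and N3_deriv = has_vector_derivative_deriv_in[OF frame_differentiable(2)]

text \<open>Both sides are the determinant of \<open>T, N1, D 3, N3\<close>: on the left up to a cyclic permutation of the
  rows, on the right because \<open>T\<close> and \<open>N1\<close> are multiples of \<open>D 1\<close> and \<open>D 2\<close>. The sign in the definition
  of \<open>N2\<close> is what makes the value positive, and with it \<open>\<kappa>2\<close>.\<close>

lemma D3_inner_N2: "s \<in> I \<Longrightarrow> D 3 s \<bullet> N2 s = norm (osc_normal I \<gamma> s) / norm (D 2 s)"
proof -
  assume s: "s \<in> I"
  have "D 3 s \<bullet> N2 s = vector_prod (T s) (N1 s) (D 3 s) \<bullet> N3 s"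
    unfolding frenet_n2_def
    by (simp add: inner_commute[of "D 3 s"] vector_prod_swap34[of _ _ "D 3 s"]
        vector_prod_swap23[of "T s" "N3 s"] vector_prod_swap12[of "N3 s" "T s"] del: funpow.simps)
  also have "vector_prod (T s) (N1 s) (D 3 s) = osc_normal I \<gamma> s /\<^sub>R norm (D 2 s)"
    by (simp add: T_eq[OF s] N1_eq[OF s] osc_normal_D vector_prod_scaleR2 del: funpow.simps One_nat_def)
  finally show ?thesis
    using osc_normal_nonzero[OF s]
    by (simp add: frenet_n3_def divide_simps power2_norm_eq_inner[symmetric] power2_eq_square del: funpow.simps)
qed

text \<open>Transfer from \<open>D 3\<close> to the derivative of \<open>N1\<close> goes through the derivative of \<open>N2\<close>, since both \<open>N1\<close> and
  its multiple \<open>D 2\<close> are orthogonal to \<open>N2\<close>. The same argument with \<open>N3\<close> gives the lemma after this one.\<close>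

lemma N1_deriv_N2:
  assumes s: "s \<in> I"
  shows "deriv_in I N1 s \<bullet> N2 s = norm (osc_normal I \<gamma> s) / (norm (D 2 s))\<^sup>2"
proof -
  have "D 2 u \<bullet> N2 u = 0" if "u \<in> I" for u
    using frame_inner[OF that] D2_eq[OF that] by (metis inner_scaleR_left mult_zero_right)
  from inner_constant_derivative[OF s this derivative_D[OF s] N2_deriv[OF s]]
  have "D 3 s \<bullet> N2 s = - (D 2 s \<bullet> deriv_in I N2 s)"
    by (simp add: numeral_3_eq_3 numeral_2_eq_2)
  moreover have "deriv_in I N1 s \<bullet> N2 s = - (N1 s \<bullet> deriv_in I N2 s)"
    by (rule inner_constant_derivative[OF s _ N1_deriv[OF s] N2_deriv[OF s]]) (rule frame_inner)
  ultimately show ?thesis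
    using D3_inner_N2[OF s] D2_nonzero[OF s]
    by (simp add: N1_eq[OF s] field_simps power2_eq_square)
qed

lemma N1_deriv_N3:
  assumes s: "s \<in> I"
  shows "deriv_in I N1 s \<bullet> N3 s = 0"
proof -
  have "D 2 u \<bullet> N3 u = 0" if "u \<in> I" for u
    using frame_inner[OF that] D2_eq[OF that] by (metis inner_scaleR_left mult_zero_right)
  from inner_constant_derivative[OF s this derivative_D[OF s] N3_deriv[OF s]]
  have "D 3 s \<bullet> N3 s = - (D 2 s \<bullet> deriv_in I N3 s)"
    by (simp add: numeral_3_eq_3 numeral_2_eq_2)
  moreover have "deriv_in I N1 s \<bullet> N3 s = - (N1 s \<bullet> deriv_in I N3 s)"
    by (rule inner_constant_derivative[OF s _ N1_deriv[OF s] N3_deriv[OF s]]) (rule frame_inner)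
  ultimately show ?thesis
    using N3_orthogonal(3)[OF s] by (simp add: N1_eq[OF s])
qed

text \<open>Differentiating the orthonormality relations shows that the coefficients of the derivatives of the
  frame form a skew-symmetric matrix. It is tridiagonal because the derivative of \<open>T\<close> is parallel to
  \<open>N1\<close> and that of \<open>N1\<close> is orthogonal to \<open>N3\<close>.\<close>

lemma frenet_equations_hold:
  assumes s: "s \<in> I"
  shows "frenet_equations I \<gamma> s (norm (D 2 s)) (deriv_in I N1 s \<bullet> N2 s) (deriv_in I N2 s \<bullet> N3 s)"
proof -
  note pair = inner_constant_derivative[OF s]
  note d = T_deriv[OF s] N1_deriv[OF s] N2_deriv[OF s] N3_deriv[OF s]
  have T: "deriv_in I T s = norm (D 2 s) *\<^sub>R N1 s"
    using deriv_in_eq[OF s T_deriv[OF s]] D2_eq[OF s] by simp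
  have DT: "D 2 s \<bullet> N1 s = norm (D 2 s)" "D 2 s \<bullet> N2 s = 0" "D 2 s \<bullet> N3 s = 0"
    by (subst D2_eq[OF s], simp add: frame_inner[OF s])+
  have N1: "deriv_in I N1 s \<bullet> T s = - norm (D 2 s)" "deriv_in I N1 s \<bullet> N1 s = 0"
    using pair[OF frame_inner(11) d(2) d(1)] pair[OF frame_inner(2) d(2) d(2)] DT
    by (simp_all add: inner_commute)
  have N2: "deriv_in I N2 s \<bullet> T s = 0" "deriv_in I N2 s \<bullet> N1 s = - (deriv_in I N1 s \<bullet> N2 s)"
    "deriv_in I N2 s \<bullet> N2 s = 0"
    using pair[OF frame_inner(12) d(3) d(1)] pair[OF frame_inner(14) d(3) d(2)]
      pair[OF frame_inner(3) d(3) d(3)] DT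
    by (simp_all add: inner_commute)
  have N3: "deriv_in I N3 s \<bullet> T s = 0" "deriv_in I N3 s \<bullet> N1 s = 0"
    "deriv_in I N3 s \<bullet> N2 s = - (deriv_in I N2 s \<bullet> N3 s)" "deriv_in I N3 s \<bullet> N3 s = 0"
    using pair[OF frame_inner(13) d(4) d(1)] pair[OF frame_inner(15) d(4) d(2)]
      pair[OF frame_inner(16) d(4) d(3)] pair[OF frame_inner(4) d(4) d(4)] DT N1_deriv_N3[OF s]
    by (simp_all add: inner_commute)
  show ?thesis
    unfolding frenet_equations_def speed[OF s] T
    using D2_nonzero[OF s] osc_normal_nonzero[OF s] N1_deriv_N2[OF s]
      frame_expand[OF s, of "deriv_in I N1 s"] frame_expand[OF s, of "deriv_in I N2 s"]
      frame_expand[OF s, of "deriv_in I N3 s"]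
    by (simp add: N1 N2 N3 N1_deriv_N3[OF s])
qed

lemma frenet_equations_iff:
  assumes s: "s \<in> I"
  shows "frenet_equations I \<gamma> s k1 k2 k3 \<longleftrightarrow>
    k1 = norm (D 2 s) \<and> k2 = deriv_in I N1 s \<bullet> N2 s \<and> k3 = deriv_in I N2 s \<bullet> N3 s"
proof
  assume "frenet_equations I \<gamma> s k1 k2 k3"
  then have "deriv_in I T s \<bullet> N1 s = k1" "deriv_in I N1 s \<bullet> N2 s = k2" "deriv_in I N2 s \<bullet> N3 s = k3"
    unfolding frenet_equations_def by (simp_all add: speed[OF s] frame_inner[OF s] inner_simps)
  moreover have "deriv_in I T s \<bullet> N1 s = norm (D 2 s)"
    using frenet_equations_hold[OF s]
    unfolding frenet_equations_def by (simp add: speed[OF s] frame_inner[OF s])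
  ultimately show "k1 = norm (D 2 s) \<and> k2 = deriv_in I N1 s \<bullet> N2 s \<and> k3 = deriv_in I N2 s \<bullet> N3 s"
    by simp
qed (use frenet_equations_hold[OF s] in simp)

lemma curvature_eq:
  assumes "s \<in> I"
  shows "\<kappa>1 s = norm (D 2 s)" "\<kappa>2 s = deriv_in I N1 s \<bullet> N2 s" "\<kappa>3 s = deriv_in I N2 s \<bullet> N3 s"
  unfolding curvature1_def curvature2_def curvature3_def frenet_equations_iff[OF assms]
  by (auto intro: the_equality)

lemma frenet:
  assumes s: "s \<in> I"
  shows "\<kappa>1 s > 0" "\<kappa>2 s > 0"
    "(T has_vector_derivative \<kappa>1 s *\<^sub>R N1 s) (at s within I)"
    "(N1 has_vector_derivative - \<kappa>1 s *\<^sub>R T s + \<kappa>2 s *\<^sub>R N2 s) (at s within I)"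
    "(N2 has_vector_derivative - \<kappa>2 s *\<^sub>R N1 s + \<kappa>3 s *\<^sub>R N3 s) (at s within I)"
proof -
  have eqs: "frenet_equations I \<gamma> s (\<kappa>1 s) (\<kappa>2 s) (\<kappa>3 s)"
    unfolding curvature_eq[OF s] by (rule frenet_equations_hold[OF s])
  then show "\<kappa>1 s > 0" "\<kappa>2 s > 0"
    by (simp_all add: frenet_equations_def)
  have "deriv_in I T s = \<kappa>1 s *\<^sub>R N1 s" "deriv_in I N1 s = - \<kappa>1 s *\<^sub>R T s + \<kappa>2 s *\<^sub>R N2 s"
    "deriv_in I N2 s = - \<kappa>2 s *\<^sub>R N1 s + \<kappa>3 s *\<^sub>R N3 s"
    using eqs unfolding frenet_equations_def by (simp_all add: speed[OF s])
  moreover have "deriv_in I T s = D 2 s"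
    by (rule deriv_in_eq[OF s T_deriv[OF s]])
  ultimately show "(T has_vector_derivative \<kappa>1 s *\<^sub>R N1 s) (at s within I)"
    "(N1 has_vector_derivative - \<kappa>1 s *\<^sub>R T s + \<kappa>2 s *\<^sub>R N2 s) (at s within I)"
    "(N2 has_vector_derivative - \<kappa>2 s *\<^sub>R N1 s + \<kappa>3 s *\<^sub>R N3 s) (at s within I)"
    using T_deriv[OF s] N1_deriv[OF s] N2_deriv[OF s] by metis+
qed

end

section \<open>Offsets along the first normal\<close>

context unit_speed_curve
begin

definition offset :: "real \<Rightarrow> real \<Rightarrow> real^4" where
  "offset l s = \<gamma> s + l *\<^sub>R N1 s"

abbreviation "E l k \<equiv> (deriv_in I ^^ k) (offset l)"

lemma offset_deriv:
  assumes s: "s \<in> I"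
  shows "(offset l has_vector_derivative T s + l *\<^sub>R deriv_in I N1 s) (at s within I)"
proof -
  have "(\<gamma> has_vector_derivative T s) (at s within I)"
    using derivative_D[OF s, of 0] by (simp add: T_eq[OF s])
  then show ?thesis
    unfolding offset_def[abs_def] using N1_deriv[OF s] by (auto intro!: derivative_eq_intros)
qed

lemma deriv_offset: "s \<in> I \<Longrightarrow> E l 1 s = T s + l *\<^sub>R deriv_in I N1 s"
  using deriv_in_eq[OF _ offset_deriv] by simp

lemma deriv_N1: "s \<in> I \<Longrightarrow> deriv_in I N1 s = - \<kappa>1 s *\<^sub>R T s + \<kappa>2 s *\<^sub>R N2 s"
  using deriv_in_eq[OF _ frenet(4)] .

lemma deriv_N1_inner:
  assumes "s \<in> I"
  shows "T s \<bullet> deriv_in I N1 s = - \<kappa>1 s" "N1 s \<bullet> deriv_in I N1 s = 0"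
    "deriv_in I N1 s \<bullet> deriv_in I N1 s = (\<kappa>1 s)\<^sup>2 + (\<kappa>2 s)\<^sup>2"
  by (simp_all add: deriv_N1 assms inner_simps frame_inner power2_eq_square)

lemma D2_curvature: "s \<in> I \<Longrightarrow> D 2 s = \<kappa>1 s *\<^sub>R N1 s"
  using D2_eq curvature_eq(1) by metis

text \<open>Orthogonality of \<open>N1\<close> to three consecutive derivatives of the offset passes to orthogonality of its
  derivative to the first two. One of the resulting equations is the relation between the curvatures,
  the other one says that \<open>\<kappa>1\<^sup>2 + \<kappa>2\<^sup>2\<close>, the squared norm of the derivative of \<open>N1\<close>, is constant.\<close>

lemma offset_orthogonal_imp_constant_curvatures:
  assumes l: "l \<noteq> 0" and smooth_offset: "smooth_in I (offset l)"
    and ortho: "\<And>s k. s \<in> I \<Longrightarrow> k \<in> {1, 2, 3} \<Longrightarrow> E l k s \<bullet> N1 s = 0"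
  obtains k1 k2 where "k1 > 0" "k2 > 0" "\<And>s. s \<in> I \<Longrightarrow> \<kappa>1 s = k1" "\<And>s. s \<in> I \<Longrightarrow> \<kappa>2 s = k2"
    "l * (k1\<^sup>2 + k2\<^sup>2) = k1"
proof -
  let ?N1' = "deriv_in I N1"
  have E_deriv: "(E l k has_vector_derivative E l (Suc k) s) (at s within I)" if "s \<in> I" for k s
    using smooth_in_iterated_derivative[OF smooth_offset that] .
  have ortho': "E l k s \<bullet> ?N1' s = 0" if s: "s \<in> I" and k: "k \<in> {1, 2}" for k s
  proof -
    have "E l (Suc k) s \<bullet> N1 s = - (E l k s \<bullet> ?N1' s)"
      by (rule inner_constant_derivative[OF s _ E_deriv[OF s] N1_deriv[OF s]])
        (use ortho k in blast)
    moreover have "E l (Suc k) s \<bullet> N1 s = 0"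
      using k by (intro ortho[OF s]) auto
    ultimately show ?thesis
      by simp
  qed
  have relation: "l * ((\<kappa>1 s)\<^sup>2 + (\<kappa>2 s)\<^sup>2) = \<kappa>1 s" if s: "s \<in> I" for s
    using ortho'[OF s, of 1] unfolding deriv_offset[OF s] by (simp add: inner_simps deriv_N1_inner[OF s])
  \<comment> \<open>The derivative of \<open>N1\<close> inherits its differentiability from the offset.\<close>
  have N1': "?N1' s = (1 / l) *\<^sub>R (E l 1 s - T s)" if "s \<in> I" for s
    using l unfolding deriv_offset[OF that] by simp
  have N1'_deriv: "(?N1' has_vector_derivative (1 / l) *\<^sub>R (E l 2 s - D 2 s)) (at s within I)"
    if s: "s \<in> I" for s
  proof -
    have "((\<lambda>u. (1 / l) *\<^sub>R (E l 1 u - T u)) has_vector_derivative (1 / l) *\<^sub>R (E l 2 s - D 2 s))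
        (at s within I)"
      using E_deriv[OF s, of 1] T_deriv[OF s]
      by (auto intro!: derivative_eq_intros simp: numeral_2_eq_2)
    then show ?thesis
      using has_vector_derivative_cong_on[of ?N1' "\<lambda>u. (1 / l) *\<^sub>R (E l 1 u - T u)" s, OF N1' s] by blast
  qed
  have "((\<lambda>u. ?N1' u \<bullet> ?N1' u) has_vector_derivative 0) (at s within I)" if s: "s \<in> I" for s
  proof -
    have "?N1' s \<bullet> (E l 2 s - D 2 s) = 0"
      using ortho'[OF s, of 2] deriv_N1_inner(2)[OF s] unfolding D2_curvature[OF s]
      by (simp add: inner_simps inner_commute[of "?N1' s"])
    then show ?thesis
      using bounded_bilinear.has_vector_derivative[OF bounded_bilinear_inner N1'_deriv[OF s] N1'_deriv[OF s]]
      by (simp add: inner_commute[of "E l 2 s - D 2 s"])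
  qed
  from has_vector_derivative_zero_constant[OF is_interval_convex[OF interval] this]
  obtain c where "\<And>s. s \<in> I \<Longrightarrow> ?N1' s \<bullet> ?N1' s = c"
    by blast
  then have c: "(\<kappa>1 s)\<^sup>2 + (\<kappa>2 s)\<^sup>2 = c" if "s \<in> I" for s
    using deriv_N1_inner(3)[OF that] that by simp
  have k1: "\<kappa>1 s = l * c" if "s \<in> I" for s
    using relation[OF that] c[OF that] by simp
  \<comment> \<open>Positivity of \<open>\<kappa>2\<close> selects the root.\<close>
  have k2: "\<kappa>2 s = sqrt (c - (l * c)\<^sup>2)" if "s \<in> I" for s
    using c[OF that] k1[OF that] frenet(2)[OF that] by (intro real_sqrt_unique[symmetric]) auto
  obtain s0 where s0: "s0 \<in> I"
    using interior_nonempty interior_subset by blast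
  show thesis
    using frenet(1,2)[OF s0] k1 k2 relation[OF s0] s0
    by (intro that[of "\<kappa>1 s0" "\<kappa>2 s0"]) auto
qed

lemma offset_derivatives_of_constant_curvatures:
  assumes s: "s \<in> I"
    and const: "\<And>u. u \<in> I \<Longrightarrow> \<kappa>1 u = k1" "\<And>u. u \<in> I \<Longrightarrow> \<kappa>2 u = k2"
    and relation: "l * (k1\<^sup>2 + k2\<^sup>2) = k1"
  shows "E l 1 s = (1 - l * k1) *\<^sub>R T s + (l * k2) *\<^sub>R N2 s"
    and "E l 2 s = (l * k2 * \<kappa>3 s) *\<^sub>R N3 s"
proof -
  have first: "E l 1 u = (1 - l * k1) *\<^sub>R T u + (l * k2) *\<^sub>R N2 u" if "u \<in> I" for u
    unfolding deriv_offset[OF that] deriv_N1[OF that] using const[OF that] by (simp add: algebra_simps)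
  then show "E l 1 s = (1 - l * k1) *\<^sub>R T s + (l * k2) *\<^sub>R N2 s"
    using s .
  have "((\<lambda>u. (1 - l * k1) *\<^sub>R T u + (l * k2) *\<^sub>R N2 u) has_vector_derivative
      (1 - l * k1) *\<^sub>R (k1 *\<^sub>R N1 s) + (l * k2) *\<^sub>R (- k2 *\<^sub>R N1 s + \<kappa>3 s *\<^sub>R N3 s)) (at s within I)"
    using frenet(3,5)[OF s] const[OF s] by (auto intro!: derivative_eq_intros)
  then have "(E l 1 has_vector_derivative
      (1 - l * k1) *\<^sub>R (k1 *\<^sub>R N1 s) + (l * k2) *\<^sub>R (- k2 *\<^sub>R N1 s + \<kappa>3 s *\<^sub>R N3 s)) (at s within I)"
    using has_vector_derivative_cong_on[of "E l 1", OF first s] by blast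
  from deriv_in_eq[OF s this]
  have "E l 2 s = (1 - l * k1) *\<^sub>R (k1 *\<^sub>R N1 s) + (l * k2) *\<^sub>R (- k2 *\<^sub>R N1 s + \<kappa>3 s *\<^sub>R N3 s)"
    by (simp add: numeral_2_eq_2)
  also have "\<dots> = (k1 - l * (k1\<^sup>2 + k2\<^sup>2)) *\<^sub>R N1 s + (l * k2 * \<kappa>3 s) *\<^sub>R N3 s"
    by (simp add: algebra_simps power2_eq_square)
  finally show "E l 2 s = (l * k2 * \<kappa>3 s) *\<^sub>R N3 s"
    by (simp add: relation)
qed

lemma third_mates_offset_imp:
  assumes l: "l \<noteq> 0" and mates: "third_mates I \<gamma> (offset l)"
  shows "(\<exists>k1 k2. k1 > 0 \<and> k2 > 0 \<and> (\<forall>s\<in>I. \<kappa>1 s = k1 \<and> \<kappa>2 s = k2) \<and> l * (k1\<^sup>2 + k2\<^sup>2) = k1) \<and>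
    (\<forall>s\<in>I. \<kappa>3 s \<noteq> 0)"
proof -
  from mates have smooth_offset: "smooth_in I (offset l)"
    and osc: "\<And>s. s \<in> I \<Longrightarrow> osc_normal I (offset l) s \<noteq> 0"
    and normal: "\<And>s. s \<in> I \<Longrightarrow>
      N1 s = frenet_n3 I (offset l) s \<or> N1 s = - frenet_n3 I (offset l) s"
    unfolding third_mates_def nondegenerate_curve_def regular_curve_def by blast+
  have "E l k s \<bullet> N1 s = 0" if "s \<in> I" "k \<in> {1, 2, 3}" for s k
  proof -
    have "E l k s \<bullet> osc_normal I (offset l) s = 0"
      using that(2) by (auto simp: osc_normal_def simp del: funpow.simps) simp
    then show ?thesis
      using normal[OF that(1)] by (auto simp: frenet_n3_def)
  qed
  from offset_orthogonal_imp_constant_curvatures[OF l smooth_offset this]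
  obtain k1 k2 where pos: "k1 > 0" "k2 > 0"
    and const: "\<And>s. s \<in> I \<Longrightarrow> \<kappa>1 s = k1" "\<And>s. s \<in> I \<Longrightarrow> \<kappa>2 s = k2"
    and relation: "l * (k1\<^sup>2 + k2\<^sup>2) = k1"
    by blast
  have "\<kappa>3 s \<noteq> 0" if s: "s \<in> I" for s
  proof
    assume "\<kappa>3 s = 0"
    then have "E l 2 s = 0"
      using offset_derivatives_of_constant_curvatures(2)[OF s const relation] by simp
    then show False
      using osc[OF s] by (simp add: osc_normal_def del: funpow.simps)
  qed
  then show ?thesis
    using pos const relation by blast
qed

text \<open>Only one combination of the \<open>T\<close>- and \<open>N2\<close>-components of the third derivative enters the vector
  product. It is found by differentiating the orthogonality of the second derivative, a multiple of
  \<open>N3\<close>, to a fixed combination of \<open>T\<close> and \<open>N2\<close>.\<close>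

lemma third_mates_offset:
  assumes l: "l \<noteq> 0" and pos: "k1 > 0" "k2 > 0"
    and const: "\<And>s. s \<in> I \<Longrightarrow> \<kappa>1 s = k1" "\<And>s. s \<in> I \<Longrightarrow> \<kappa>2 s = k2"
    and relation: "l * (k1\<^sup>2 + k2\<^sup>2) = k1"
    and torsion: "\<And>s. s \<in> I \<Longrightarrow> \<kappa>3 s \<noteq> 0"
  shows "third_mates I \<gamma> (offset l)"
proof -
  define p q where "p = 1 - l * k1" and "q = l * k2"
  have q: "q \<noteq> 0"
    using l pos by (simp add: q_def)
  have "k1 * p = q * k2"
    using relation by (simp add: p_def q_def algebra_simps power2_eq_square)
  with q pos have p: "p \<noteq> 0"
    by auto
  have "offset l s = \<gamma> s + (l / k1) *\<^sub>R D 2 s" if "s \<in> I" for s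
    using pos by (simp add: offset_def D2_curvature[OF that] const[OF that])
  then have smooth_offset: "smooth_in I (offset l)"
    by (rule smooth_in_add_scaleR_derivative[OF smooth])
  have E1: "E l 1 s = p *\<^sub>R T s + q *\<^sub>R N2 s" and E2: "E l 2 s = (q * \<kappa>3 s) *\<^sub>R N3 s"
    if "s \<in> I" for s
    using offset_derivatives_of_constant_curvatures[OF that const relation]
    by (simp_all add: p_def q_def)
  have osc: "\<exists>m. m \<noteq> 0 \<and> osc_normal I (offset l) s = m *\<^sub>R N1 s" if s: "s \<in> I" for s
  proof -
    let ?V = "vector_prod (T s) (N3 s) (N2 s)"
    let ?e = "E l 3 s"
    have E2_deriv: "(E l 2 has_vector_derivative ?e) (at s within I)"
      using smooth_in_iterated_derivative[OF smooth_offset s, of 2] by (simp add: eval_nat_numeral)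
    have "?e \<bullet> N1 s = - (E l 2 s \<bullet> deriv_in I N1 s)"
      by (rule inner_constant_derivative[OF s _ E2_deriv N1_deriv[OF s]])
        (simp add: E2 frame_inner)
    then have e1: "?e \<bullet> N1 s = 0"
      by (simp add: E2[OF s] deriv_N1[OF s] inner_simps frame_inner[OF s])
    \<comment> \<open>\<open>q T - p N2\<close> spans the orthogonal complement of the first derivative in the plane of \<open>T\<close> and
      \<open>N2\<close>, and is orthogonal to the second derivative.\<close>
    have "((\<lambda>u. q *\<^sub>R T u - p *\<^sub>R N2 u) has_vector_derivative
        q *\<^sub>R (\<kappa>1 s *\<^sub>R N1 s) - p *\<^sub>R (- \<kappa>2 s *\<^sub>R N1 s + \<kappa>3 s *\<^sub>R N3 s)) (at s within I)"
      using frenet(3,5)[OF s] by (auto intro!: derivative_eq_intros)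
    from inner_constant_derivative[OF s _ E2_deriv this, of 0]
    have e: "?e \<bullet> T s * q - ?e \<bullet> N2 s * p = p * q * (\<kappa>3 s)\<^sup>2"
      by (simp add: E2 frame_inner s inner_simps power2_eq_square algebra_simps)
    have "osc_normal I (offset l) s = vector_prod (E l 1 s) (E l 2 s) ?e"
      by (simp add: osc_normal_def)
    also have "\<dots> = vector_prod (p *\<^sub>R T s + q *\<^sub>R N2 s) ((q * \<kappa>3 s) *\<^sub>R N3 s)
        ((?e \<bullet> T s) *\<^sub>R T s + (?e \<bullet> N2 s) *\<^sub>R N2 s + (?e \<bullet> N3 s) *\<^sub>R N3 s)"
      using frame_expand[OF s, of ?e] by (simp add: E1[OF s] E2[OF s] e1 del: funpow.simps One_nat_def)
    also have "\<dots> = (- (q * \<kappa>3 s) * (?e \<bullet> T s * q - ?e \<bullet> N2 s * p)) *\<^sub>R ?V"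
    proof -
      have "vector_prod (N2 s) (N3 s) (T s) = - ?V"
        by (simp add: vector_prod_swap12[of "N2 s" "N3 s"] vector_prod_swap23[of "N3 s" "N2 s"]
            vector_prod_swap12[of "N3 s" "T s"])
      then show ?thesis
        by (simp add: vector_prod_trilinear algebra_simps del: funpow.simps)
    qed
    also have "\<dots> = (- p * q\<^sup>2 * (\<kappa>3 s) ^ 3) *\<^sub>R ?V"
      unfolding e by (simp add: power2_eq_square power3_eq_cube)
    also have "?V = (?V \<bullet> N1 s) *\<^sub>R N1 s"
      using frame_expand[OF s, of ?V] by simp
    finally have "osc_normal I (offset l) s
        = (- p * q\<^sup>2 * (\<kappa>3 s) ^ 3 * (?V \<bullet> N1 s)) *\<^sub>R N1 s"
      by simp
    moreover have "?V \<bullet> N1 s \<noteq> 0"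
    proof
      assume "?V \<bullet> N1 s = 0"
      then have "?V = 0"
        using frame_expand[OF s, of ?V] by simp
      moreover have "norm ?V = 1"
        by (rule norm_vector_prod_orthonormal) (simp_all add: frame_unit[OF s] frame_inner[OF s])
      ultimately show False
        by simp
    qed
    ultimately show ?thesis
      using p q torsion[OF s] by (intro exI[of _ "- p * q\<^sup>2 * (\<kappa>3 s) ^ 3 * (?V \<bullet> N1 s)"]) simp
  qed
  have "deriv_in I (offset l) s \<noteq> 0" if s: "s \<in> I" for s
  proof
    assume "deriv_in I (offset l) s = 0"
    then have "(p *\<^sub>R T s + q *\<^sub>R N2 s) \<bullet> N2 s = 0"
      using E1[OF s] by simp
    then show False
      using q by (simp add: inner_simps frame_inner[OF s])
  qed
  moreover have "osc_normal I (offset l) s \<noteq> 0" if s: "s \<in> I" for s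
    using osc[OF s] norm_frame(2)[OF s] by force
  ultimately have nondegenerate_offset: "nondegenerate_curve I (offset l)"
    using smooth_offset by (simp add: nondegenerate_curve_def regular_curve_def)
  have "N1 s = frenet_n3 I (offset l) s \<or> N1 s = - frenet_n3 I (offset l) s" if s: "s \<in> I" for s
  proof -
    obtain m where "m \<noteq> 0" "osc_normal I (offset l) s = m *\<^sub>R N1 s"
      using osc[OF s] by blast
    then show ?thesis
      by (cases "m > 0") (simp_all add: frenet_n3_def norm_frame(2)[OF s])
  qed
  moreover obtain s0 where "s0 \<in> I"
    using interior_nonempty interior_subset by blast
  moreover from this have "\<gamma> s0 \<noteq> offset l s0"
    using l norm_frame(2)[of s0] by (auto simp: offset_def)
  ultimately show ?thesis
    unfolding third_mates_def
    using nondegenerate nondegenerate_offset smooth_in_const[of l] by (auto simp: offset_def)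
qed

end

theorem theorem2p9:
  fixes I :: "real set" and \<gamma> \<gamma>b :: "real \<Rightarrow> real^4" and l :: real
  assumes "is_interval I" and "interior I \<noteq> {}"
    and "nondegenerate_curve I \<gamma>" and "arclength_parametrized I \<gamma>"
    and "l \<noteq> 0"
    and "\<gamma>b = (\<lambda>s. \<gamma> s + l *\<^sub>R frenet_n1 I \<gamma> s)"
  shows "third_mates I \<gamma> \<gamma>b \<longleftrightarrow>
    (\<exists>k1 k2. k1 > 0 \<and> k2 > 0 \<and>
       (\<forall>s\<in>I. curvature1 I \<gamma> s = k1 \<and> curvature2 I \<gamma> s = k2) \<and>
       l * (k1\<^sup>2 + k2\<^sup>2) = k1) \<and>
    (\<forall>s\<in>I. curvature3 I \<gamma> s \<noteq> 0)"
proof -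
  interpret unit_speed_curve I \<gamma>
    using assms(1-4) by unfold_locales
  have offset: "\<gamma>b = offset l"
    using assms(6) by (simp add: offset_def fun_eq_iff)
  show ?thesis
    unfolding offset
    using third_mates_offset_imp[OF \<open>l \<noteq> 0\<close>] third_mates_offset[OF \<open>l \<noteq> 0\<close>] by blast
qed

end
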